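(* For all $1<p<\infty$, the first eigenvalue $\lambda(p)$ satisfies $$p<\lambda(p)<p+\frac{\pi^2}{6}-1.$$
   Context: For $1<p<\infty$, $\lambda(p)$ denotes the first (smallest) eigenvalue of the one-dimensional $p$-Laplacian on $(-1,1)$ with Dirichlet boundary conditions, i.e. the smallest $\lambda$ for which $(|u'|^{p-2}u')'+\lambda|u|^{p-2}u=0$ in $(-1,1)$, $u(-1)=u(1)=0$ has a nontrivial solution. It is known to be given explicitly by $$\lambda(p)=(p-1)\left(\frac{\pi}{p\sin(\pi/p)}\right)^p,$$ and this formula may be taken as the definition of $\lambda(p)$. *)

theory Defs
  imports Complex_Main
begin

(* lambda1 p is the first eigenvalue of the one-dimensional p-Laplacian on (-1,1) with
   Dirichlet boundary conditions, i.e. the smallest l such that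
     (|u'|^(p-2) u')' + l |u|^(p-2) u = 0 in (-1,1),   u(-1) = u(1) = 0
   has a nontrivial solution. As in the source, its known closed form is taken as the
   definition. It is meaningful only for p > 1, where sin (pi / p) > 0, so that the base of
   powr is positive. *)
definition lambda1 :: "real \<Rightarrow> real" where
  "lambda1 p = (p - 1) * (pi / (p * sin (pi / p))) powr p"

end

theory Submission
  imports Defs "HOL-Analysis.Analysis" "HOL-Real_Asymp.Real_Asymp"
begin

text \<open>
  Put \<open>x = 1 / p \<in> (0, 1)\<close>. Euler's reflection formula
  \<open>\<pi> x / sin (\<pi> x) = \<Gamma> (1 + x) \<Gamma> (1 - x)\<close> turns the closed form of the
  eigenvalue into \<open>p exp (p F(x))\<close> (lemma \<open>lambda1_eq_exp_log_defect\<close>), where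
  \<open>F(x) = ln \<Gamma> (1 + x) + ln \<Gamma> (2 - x) - (1 - x) ln (1 - x)\<close>.
  The two inequalities become \<open>0 < F(x) < x ln (1 + c x)\<close> with \<open>c = \<pi>\<^sup>2 / 6 - 1\<close>.
  One has \<open>F(0) = F'(0) = F(1) = 0\<close> and \<open>F''(x) = h(x) - 1 / (1 - x)\<close> with
  \<open>h(x) = \<psi>'(1 + x) + \<psi>'(2 - x)\<close>, where \<open>\<psi>'\<close> is the trigamma function.

  Lower bound: \<open>(1 - x) h(x)\<close> is strictly decreasing, so \<open>F''\<close> changes sign at most once, from
  positive to negative. Thus \<open>F\<close> first increases from \<open>F(0) = F'(0) = 0\<close>, being convex, and is
  then concave down to the value \<open>F(1) = 0\<close>, which forces \<open>F > 0\<close> on \<open>(0, 1)\<close>.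

  Upper bound: \<open>G(x) = x ln (1 + c x) - F(x)\<close> satisfies \<open>G(0) = G'(0) = 0\<close>, and it is strictly
  convex: convexity of \<open>\<psi>'\<close>, sharpened by treating the first term of its series by hand, gives
  \<open>h(x) \<le> 1 + 2 c - x (1 - x)\<close>, where \<open>h(0) = 1 + 2 c\<close> is the Basel sum, and this implies
  \<open>G'' > 0\<close> because \<open>3 c\<^sup>2 < 2\<close>.
\<close>

section \<open>The trigamma function\<close>

lemma trigamma_sums:
  fixes z :: real
  assumes "z > 0"
  shows "(\<lambda>n. 1 / (z + real n)\<^sup>2) sums Polygamma 1 z"
  using Polygamma_LIMSEQ[of z 1] assms by (simp add: inverse_eq_divide power2_eq_square)

lemma trigamma_pos:
  fixes z :: real
  assumes "z > 0"
  shows "Polygamma 1 z > 0"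
proof -
  have "z \<notin> \<int>\<^sub>\<le>\<^sub>0"
    using assms by (auto elim!: nonpos_Ints_cases)
  then show ?thesis
    by (intro Polygamma_real_odd_pos) auto
qed

lemma trigamma_plus1:
  fixes z :: real
  assumes "z > 0"
  shows "Polygamma 1 (z + 1) = Polygamma 1 z - 1 / z\<^sup>2"
  using Polygamma_plus1[of z 1] assms by (simp add: power2_eq_square)

lemma trigamma_1: "Polygamma 1 (1 :: real) = pi\<^sup>2 / 6"
  using trigamma_sums[of 1] inverse_squares_sums by (simp add: sums_iff add.commute)

lemma convex_on_trigamma: "convex_on {0 :: real<..} (Polygamma 1)"
proof (rule f''_ge0_imp_convex)
  fix z :: real
  assume "z \<in> {0<..}"
  then have z: "z \<notin> \<int>\<^sub>\<le>\<^sub>0"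
    by (auto elim!: nonpos_Ints_cases)
  show "(Polygamma 1 has_real_derivative Polygamma 2 z) (at z)"
    using has_field_derivative_Polygamma[OF z, of 1] by (simp add: numeral_2_eq_2)
  show "(Polygamma 2 has_real_derivative Polygamma 3 z) (at z)"
    using has_field_derivative_Polygamma[OF z, of 2] by (simp add: numeral_3_eq_3 numeral_2_eq_2)
  show "Polygamma 3 z \<ge> 0"
    using Polygamma_real_odd_pos[OF z, of 3] by simp
qed auto

lemma trigamma_symmetric_le:
  fixes z x :: real
  assumes "z > 0" "0 \<le> x" "x \<le> 1"
  shows "Polygamma 1 (z + x) + Polygamma 1 (z + 1 - x) \<le> Polygamma 1 z + Polygamma 1 (z + 1)"
proof -
  have *: "Polygamma 1 (z + t) \<le> (1 - t) * Polygamma 1 z + t * Polygamma 1 (z + 1)"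
    if "0 \<le> t" "t \<le> 1" for t
  proof -
    have "Polygamma 1 ((1 - t) *\<^sub>R z + t *\<^sub>R (z + 1))
            \<le> (1 - t) * Polygamma 1 z + t * Polygamma 1 (z + 1)"
      using that assms by (intro convex_onD[OF convex_on_trigamma]) auto
    then show ?thesis
      by (simp add: algebra_simps)
  qed
  have "Polygamma 1 (z + 1 - x) \<le> x * Polygamma 1 z + (1 - x) * Polygamma 1 (z + 1)"
    using *[of "1 - x"] assms by (simp add: algebra_simps)
  with *[of x] assms show ?thesis
    by (simp add: algebra_simps)
qed

text \<open>Each term \<open>y / (a + y)\<^sup>2\<close> of the series, with \<open>a \<ge> 1\<close>, is increasing in \<open>y\<close> up to \<open>y = a\<close>.\<close>
lemma mult_trigamma_mono:
  fixes y z :: real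
  assumes "0 < y" "y \<le> z" "z \<le> 1"
  shows "y * Polygamma 1 (1 + y) \<le> z * Polygamma 1 (1 + z)"
proof (rule sums_le)
  show "(\<lambda>n. y * (1 / (1 + y + real n)\<^sup>2)) sums (y * Polygamma 1 (1 + y))"
    using assms by (intro sums_mult trigamma_sums) auto
  show "(\<lambda>n. z * (1 / (1 + z + real n)\<^sup>2)) sums (z * Polygamma 1 (1 + z))"
    using assms by (intro sums_mult trigamma_sums) auto
  fix n :: nat
  define a where "a = 1 + real n"
  have a: "a \<ge> 1"
    by (simp add: a_def)
  have "y * z \<le> 1 * 1"
    using assms by (intro mult_mono) auto
  also have "\<dots> \<le> a * a"
    using a by (intro mult_mono) auto
  finally have "0 \<le> (z - y) * (a * a - y * z)"
    using assms by simp
  then have "y * (a + z)\<^sup>2 \<le> z * (a + y)\<^sup>2"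
    by (simp add: power2_eq_square algebra_simps)
  then have "y / (a + y)\<^sup>2 \<le> z / (a + z)\<^sup>2"
    using assms a by (simp add: frac_le_eq divide_simps)
  then show "y * (1 / (1 + y + real n)\<^sup>2) \<le> z * (1 / (1 + z + real n)\<^sup>2)"
    by (simp add: a_def add_ac)
qed

section \<open>The logarithmic defect\<close>

text \<open>
  The function \<open>F\<close> with \<open>F(1 / p) = ln (\<lambda>(p) / p) / p\<close>. At \<open>x = 1\<close> the convention \<open>ln 0 = 0\<close>
  gives the limit value \<open>F(1) = 0\<close>.
\<close>
definition log_defect :: "real \<Rightarrow> real" where
  "log_defect x = ln_Gamma (1 + x) + ln_Gamma (2 - x) - (1 - x) * ln (1 - x)"

text \<open>The first derivative of \<open>log_defect\<close> on \<open>[0, 1)\<close>.\<close>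
definition log_defect' :: "real \<Rightarrow> real" where
  "log_defect' x = Digamma (1 + x) - Digamma (2 - x) + ln (1 - x) + 1"

text \<open>
  The second derivative of \<open>ln \<Gamma> (1 + x) + ln \<Gamma> (2 - x)\<close>, the part of \<open>log_defect\<close> that is
  smooth on \<open>[0, 1]\<close>.
\<close>
definition trigamma_pair :: "real \<Rightarrow> real" where
  "trigamma_pair x = Polygamma 1 (1 + x) + Polygamma 1 (2 - x)"

lemma has_field_derivative_log_defect:
  assumes "0 \<le> x" "x < 1"
  shows "(log_defect has_real_derivative log_defect' x) (at x)"
  unfolding log_defect_def [abs_def] log_defect'_def
  by (rule derivative_eq_intros
        DERIV_chain2[of ln_Gamma, OF has_field_derivative_ln_Gamma_real] refl
      | use assms in \<open>simp add: field_simps\<close>)+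

lemma has_field_derivative_log_defect':
  assumes "0 \<le> x" "x < 1"
  shows "(log_defect' has_real_derivative trigamma_pair x - 1 / (1 - x)) (at x)"
proof -
  have "1 + x \<notin> \<int>\<^sub>\<le>\<^sub>0" "2 - x \<notin> \<int>\<^sub>\<le>\<^sub>0"
    using assms by (auto elim!: nonpos_Ints_cases)
  then show ?thesis
    unfolding log_defect'_def [abs_def] trigamma_pair_def
    by - (rule derivative_eq_intros
        DERIV_chain2[of "Polygamma 0", OF has_field_derivative_Polygamma] refl
      | use assms in \<open>simp add: field_simps\<close>)+
qed

lemma log_defect_0 [simp]: "log_defect 0 = 0"
  and log_defect_1 [simp]: "log_defect 1 = 0"
  using ln_Gamma_real_conv_fact[of 1] ln_Gamma_real_conv_fact[of 2]
  by (simp_all add: log_defect_def)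

lemma log_defect'_0 [simp]: "log_defect' 0 = 0"
  using Digamma_plus1[of "1 :: real"] by (simp add: log_defect'_def)

lemma continuous_on_log_defect: "continuous_on {0..1} log_defect"
proof -
  have *: "continuous_on {0..1 :: real} (\<lambda>x. (1 - x) * ln (1 - x))"
    unfolding continuous_on_eq_continuous_within
  proof
    fix x :: real
    assume x: "x \<in> {0..1}"
    show "continuous (at x within {0..1}) (\<lambda>x. (1 - x) * ln (1 - x))"
    proof (cases "x = 1")
      case False
      with x show ?thesis
        by (intro continuous_intros) auto
    next
      case True
      have "((\<lambda>x :: real. (1 - x) * ln (1 - x)) \<longlongrightarrow> 0) (at_left 1)"
        by real_asymp
      moreover have "at (1 :: real) within {0..1} = at_left 1"
        by (rule at_within_Icc_at_left) simp
      ultimately show ?thesis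
        by (simp add: True continuous_within)
    qed
  qed
  have ln_Gamma: "continuous_on {1..2 :: real} ln_Gamma"
    by (intro continuous_at_imp_continuous_on ballI
        DERIV_isCont[OF has_field_derivative_ln_Gamma_real]) auto
  have "continuous_on {0..1 :: real} (\<lambda>x. ln_Gamma (1 + x))"
    by (rule continuous_on_compose2[OF ln_Gamma]) (auto intro!: continuous_intros)
  moreover have "continuous_on {0..1 :: real} (\<lambda>x. ln_Gamma (2 - x))"
    by (rule continuous_on_compose2[OF ln_Gamma]) (auto intro!: continuous_intros)
  ultimately show ?thesis
    unfolding log_defect_def [abs_def] using * by (intro continuous_on_add continuous_on_diff)
qed

section \<open>The eigenvalue in terms of the logarithmic defect\<close>

lemma Gamma_reflection_real:
  fixes x :: real
  shows "Gamma x * Gamma (1 - x) = pi / sin (pi * x)"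
proof -
  have "complex_of_real (Gamma x * Gamma (1 - x)) = complex_of_real (pi / sin (pi * x))"
    using Gamma_reflection_complex[of "of_real x"]
    by (simp flip: Gamma_complex_of_real sin_of_real)
  then show ?thesis
    by (simp only: of_real_eq_iff)
qed

lemma lambda1_eq_exp_log_defect:
  assumes "1 < p"
  shows "lambda1 p = p * exp (p * log_defect (1 / p))"
proof -
  define x where "x = 1 / p"
  have x: "0 < x" "x < 1" and px: "p * x = 1"
    using assms by (auto simp: x_def)
  have nonpos: "x \<notin> \<int>\<^sub>\<le>\<^sub>0" "1 - x \<notin> \<int>\<^sub>\<le>\<^sub>0"
    using x by (auto elim!: nonpos_Ints_cases)
  have "Gamma (1 + x) * Gamma (2 - x) = x * (1 - x) * (Gamma x * Gamma (1 - x))"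
    using Gamma_plus1[OF nonpos(1)] Gamma_plus1[OF nonpos(2)] by (simp add: add.commute)
  also have "\<dots> = (1 - x) * (pi * x / sin (pi * x))"
    by (simp add: Gamma_reflection_real)
  finally have base: "pi * x / sin (pi * x) = Gamma (1 + x) * Gamma (2 - x) / (1 - x)"
    using x by simp
  have "Gamma (1 + x) > 0" "Gamma (2 - x) > 0"
    using x by (auto intro!: Gamma_real_pos)
  then have ln_base: "ln (pi * x / sin (pi * x)) = log_defect x - x * ln (1 - x)"
    and base_pos: "pi * x / sin (pi * x) > 0"
    unfolding base using x
    by (auto simp add: less_imp_neq[THEN not_sym] ln_div ln_mult ln_Gamma_real_pos log_defect_def algebra_simps)
  have "lambda1 p = (p - 1) * (pi * x / sin (pi * x)) powr p"
    by (simp add: lambda1_def x_def)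
  also have "\<dots> = (p - 1) * exp (p * (log_defect x - x * ln (1 - x)))"
    unfolding powr_def ln_base using base_pos
    by (auto simp del: zero_less_divide_iff divide_eq_0_iff)
  also have "p * (log_defect x - x * ln (1 - x)) = p * log_defect x - (p * x) * ln (1 - x)"
    by (simp add: algebra_simps)
  also have "(p - 1) * exp (p * log_defect x - (p * x) * ln (1 - x))
      = (p - 1) / (1 - x) * exp (p * log_defect x)"
    using x by (simp add: px exp_diff)
  also have "(p - 1) / (1 - x) = p"
    using assms by (simp add: x_def field_simps)
  finally show ?thesis
    by (simp add: x_def)
qed

section \<open>The lower bound\<close>

lemma mult_trigamma_pair_strict_antimono:
  assumes "0 \<le> x" "x < y" "y < 1"
  shows "(1 - y) * trigamma_pair y < (1 - x) * trigamma_pair x"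
proof -
  have "(1 - y) * Polygamma 1 (1 + y) < (1 - x) * Polygamma 1 (1 + x)"
    using assms Polygamma_real_strict_antimono[of "1 + x" "1 + y" 1]
      trigamma_pos[of "1 + y"]
    by (intro mult_strict_mono) auto
  moreover have "(1 - y) * Polygamma 1 (2 - y) \<le> (1 - x) * Polygamma 1 (2 - x)"
    using mult_trigamma_mono[of "1 - y" "1 - x"] assms by simp
  ultimately show ?thesis
    by (simp add: trigamma_pair_def algebra_simps)
qed

lemma log_defect_pos:
  assumes "0 < x" "x < 1"
  shows "log_defect x > 0"
proof (rule ccontr)
  assume "\<not> log_defect x > 0"
  then have le: "log_defect x \<le> 0"
    by simp
  have slope: "\<exists>t. a < t \<and> t < b \<and> log_defect b - log_defect a = (b - a) * log_defect' t"
    if "0 \<le> a" "a < b" "b \<le> 1" for a b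
  proof -
    have "\<exists>l t. a < t \<and> t < b \<and> DERIV log_defect t :> l
            \<and> log_defect b - log_defect a = (b - a) * l"
    proof (rule MVT [where f = log_defect])
      show "continuous_on {a..b} log_defect"
        using continuous_on_log_defect by (rule continuous_on_subset) (use that in auto)
      show "log_defect differentiable at t" if "a < t" "t < b" for t
        using has_field_derivative_log_defect[of t] that \<open>0 \<le> a\<close> \<open>b \<le> 1\<close>
        by (auto simp: real_differentiable_def)
    qed fact
    then obtain l t where t: "a < t" "t < b" "DERIV log_defect t :> l"
      "log_defect b - log_defect a = (b - a) * l"
      by blast
    moreover have "l = log_defect' t"
      using DERIV_unique[OF t(3) has_field_derivative_log_defect[of t]] t that by simp
    ultimately show ?thesis
      by blast
  qed
  obtain r where r: "0 < r" "r < x" "log_defect x = x * log_defect' r"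
    using slope[of 0 x] assms by auto
  obtain s where s: "x < s" "s < 1" "- log_defect x = (1 - x) * log_defect' s"
    using slope[of x 1] assms by auto
  have r': "log_defect' r \<le> 0"
    using r le assms by (simp add: mult_le_0_iff)
  have "0 \<le> (1 - x) * log_defect' s"
    using s le by simp
  then have s': "log_defect' s \<ge> 0"
    using assms by (simp add: zero_le_mult_iff)
  \<comment> \<open>Whatever the sign of the second derivative at \<open>r\<close>, the decrease of \<open>(1 - t) trigamma_pair t\<close>
    contradicts
    \<open>log_defect' r \<le> 0 \<le> log_defect' s\<close>.\<close>
  show False
  proof (cases "(1 - r) * trigamma_pair r \<ge> 1")
    case True
    \<comment> \<open>The second derivative is positive on \<open>(0, r)\<close>.\<close>
    have "log_defect' 0 < log_defect' r"
    proof (rule DERIV_pos_imp_increasing_open [where f = log_defect'])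
      fix t
      assume t: "0 < t" "t < r"
      have "1 < (1 - t) * trigamma_pair t"
        using mult_trigamma_pair_strict_antimono[of t r] t r s True by simp
      then have "trigamma_pair t - 1 / (1 - t) > 0"
        using t r s by (simp add: field_simps)
      then show "\<exists>d. DERIV log_defect' t :> d \<and> d > 0"
        using has_field_derivative_log_defect'[of t] t r s by auto
    next
      show "continuous_on {0..r} log_defect'"
        by (intro continuous_at_imp_continuous_on ballI
            DERIV_isCont[OF has_field_derivative_log_defect']) (use r s in auto)
    qed (use r in simp)
    with r' show False
      by simp
  next
    case False
    \<comment> \<open>The second derivative is negative on \<open>[r, 1)\<close>.\<close>
    have "log_defect' s < log_defect' r"
    proof (rule DERIV_neg_imp_decreasing [where f = log_defect'])
      fix t
      assume t: "r \<le> t" "t \<le> s"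
      have "(1 - t) * trigamma_pair t < 1"
        using mult_trigamma_pair_strict_antimono[of r t] t r s False by (cases "r = t") auto
      then have "trigamma_pair t - 1 / (1 - t) < 0"
        using t s by (simp add: field_simps)
      then show "\<exists>d. DERIV log_defect' t :> d \<and> d < 0"
        using has_field_derivative_log_defect'[of t] t r s by auto
    qed (use r s in simp)
    with r' s' show False
      by simp
  qed
qed

section \<open>The upper bound\<close>

text \<open>
  Convexity alone would give only \<open>trigamma_pair x \<le> trigamma_pair 0\<close>; the term
  \<open>x (1 - x)\<close> is gained from the leading summands \<open>1 / (1 + x)\<^sup>2 + 1 / (2 - x)\<^sup>2\<close>.
\<close>
lemma trigamma_pair_le:
  assumes "0 \<le> x" "x \<le> 1"
  shows "trigamma_pair x \<le> pi\<^sup>2 / 3 - 1 - x * (1 - x)"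
proof -
  define t where "t = x * (1 - x)"
  have t0: "0 \<le> t"
    using assms by (simp add: t_def)
  have "0 \<le> (2 * x - 1)\<^sup>2"
    by simp
  then have t1: "t \<le> 1 / 4"
    by (simp add: t_def power2_eq_square algebra_simps)
  have "0 \<le> t * (12 - 11 * t - 4 * t\<^sup>2)"
  proof (rule mult_nonneg_nonneg)
    have "t\<^sup>2 \<le> 1"
      using t0 t1 by (intro power_le_one) auto
    then show "0 \<le> 12 - 11 * t - 4 * t\<^sup>2"
      using t1 by simp
  qed fact
  then have "5 - 2 * t \<le> (5 / 4 - t) * (2 + t)\<^sup>2"
    by (simp add: field_simps power2_eq_square)
  then have leading: "(5 - 2 * t) / (2 + t)\<^sup>2 \<le> 5 / 4 - t"
    using t0 by (simp add: pos_divide_le_eq)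
  have "1 / (1 + x)\<^sup>2 + 1 / (2 - x)\<^sup>2 = ((1 + x)\<^sup>2 + (2 - x)\<^sup>2) / ((1 + x) * (2 - x))\<^sup>2"
    using assms by (simp add: add_frac_eq power_mult_distrib add.commute)
  also have "(1 + x)\<^sup>2 + (2 - x)\<^sup>2 = 5 - 2 * t"
    by (simp add: t_def power2_eq_square algebra_simps)
  also have "(1 + x) * (2 - x) = 2 + t"
    by (simp add: t_def algebra_simps)
  finally have lead: "1 / (1 + x)\<^sup>2 + 1 / (2 - x)\<^sup>2 \<le> 5 / 4 - t"
    using leading by simp
  have tail: "Polygamma 1 (2 + x) + Polygamma 1 (3 - x) \<le> Polygamma 1 2 + Polygamma 1 3"
    using trigamma_symmetric_le[of 2 x] assms by simp
  have "Polygamma 1 (2 + x) = Polygamma 1 (1 + x) - 1 / (1 + x)\<^sup>2"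
    "Polygamma 1 (3 - x) = Polygamma 1 (2 - x) - 1 / (2 - x)\<^sup>2"
    using trigamma_plus1[of "1 + x"] trigamma_plus1[of "2 - x"] assms
    by (simp_all add: add.commute add.left_commute)
  moreover have "Polygamma 1 (2 :: real) = pi\<^sup>2 / 6 - 1"
    "Polygamma 1 (3 :: real) = pi\<^sup>2 / 6 - 1 - 1 / 4"
    using trigamma_plus1[of 1] trigamma_plus1[of 2] trigamma_1 by simp_all
  ultimately show ?thesis
    using lead tail by (simp add: trigamma_pair_def t_def)
qed

lemma log_defect_less:
  fixes x :: real
  defines "c \<equiv> pi\<^sup>2 / 6 - 1"
  assumes x: "0 < x" "x < 1"
  shows "log_defect x < x * ln (1 + c * x)"
proof -
  have "3\<^sup>2 < pi\<^sup>2"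
    using pi_approx by (intro power_strict_mono) auto
  moreover have "pi\<^sup>2 < (16 / 5)\<^sup>2"
    using pi_approx by (intro power_strict_mono) auto
  ultimately have c0: "0 < c" and c1: "c < 4 / 5"
    by (auto simp: c_def power2_eq_square)
  have "c\<^sup>2 < (4 / 5)\<^sup>2"
    using c0 c1 by (intro power_strict_mono) auto
  then have c2: "3 * c\<^sup>2 < 2"
    by (simp add: power2_eq_square)
  define g' where "g' = (\<lambda>t. ln (1 + c * t) + c * t / (1 + c * t) - log_defect' t)"
  have pos: "1 + c * t > 0" if "0 \<le> t" for t
    using c0 that by (simp add: add_pos_nonneg)
  have g: "((\<lambda>t. t * ln (1 + c * t) - log_defect t) has_real_derivative g' t) (at t)"
    if "0 \<le> t" "t < 1" for t
    unfolding g'_def using pos[of t] that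
    by (auto intro!: derivative_eq_intros has_field_derivative_log_defect simp: field_simps)
  have g': "(g' has_real_derivative
      c / (1 + c * t) + c / (1 + c * t)\<^sup>2 - (trigamma_pair t - 1 / (1 - t))) (at t)"
    if "0 \<le> t" "t < 1" for t
    unfolding g'_def using pos[of t] that
    by (auto intro!: derivative_eq_intros has_field_derivative_log_defect'
        simp: field_simps power2_eq_square)
  have g''_pos: "c / (1 + c * t) + c / (1 + c * t)\<^sup>2 - (trigamma_pair t - 1 / (1 - t)) > 0"
    if t: "0 < t" "t < 1" for t
  proof -
    define u where "u = 1 / (1 + c * t)"
    \<comment> \<open>Tangent lines at \<open>t = 0\<close> of the convex functions \<open>1 / (1 + c t)\<close> and
      \<open>1 / (1 + c t)\<^sup>2\<close>, and the geometric series up to \<open>t\<^sup>2\<close>.\<close>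
    have u1: "u \<ge> 1 - c * t"
      using pos[of t] t c0 by (simp add: u_def field_simps)
    have "0 \<le> (u - 1)\<^sup>2"
      by simp
    then have u2: "u\<^sup>2 \<ge> 1 - 2 * (c * t)"
      using u1 by (simp add: power2_eq_square algebra_simps)
    have "(1 + t + t\<^sup>2) * (1 - t) \<le> 1"
      using t by (simp add: power2_eq_square algebra_simps)
    then have geo: "1 / (1 - t) \<ge> 1 + t + t\<^sup>2"
      using t by (simp add: field_simps)
    have "c * u + c * u\<^sup>2 \<ge> c * (1 - c * t) + c * (1 - 2 * (c * t))"
      using u1 u2 c0 by (intro add_mono mult_left_mono) auto
    moreover have "trigamma_pair t \<le> 2 * c + 1 - t * (1 - t)"
      using trigamma_pair_le[of t] t by (simp add: c_def)
    ultimately have "c * u + c * u\<^sup>2 - (trigamma_pair t - 1 / (1 - t)) \<ge> t * (2 - 3 * c\<^sup>2)"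
      using geo by (simp add: power2_eq_square algebra_simps)
    moreover have "t * (2 - 3 * c\<^sup>2) > 0"
      using t c2 by simp
    ultimately show ?thesis
      by (simp add: u_def power_one_over)
  qed
  have g'_pos: "g' t > 0" if t: "0 < t" "t < 1" for t
  proof -
    have "g' 0 < g' t"
    proof (rule DERIV_pos_imp_increasing_open [where f = g'])
      show "\<exists>d. DERIV g' s :> d \<and> d > 0" if "0 < s" "s < t" for s
        using g'[of s] g''_pos[of s] that t by auto
      show "continuous_on {0..t} g'"
        by (intro continuous_at_imp_continuous_on ballI DERIV_isCont[OF g']) (use t in auto)
    qed fact
    then show ?thesis
      by (simp add: g'_def)
  qed
  have "0 * ln (1 + c * 0) - log_defect 0 < x * ln (1 + c * x) - log_defect x"
  proof (rule DERIV_pos_imp_increasing_open [where f = "\<lambda>t. t * ln (1 + c * t) - log_defect t"])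
    show "\<exists>d. DERIV (\<lambda>t. t * ln (1 + c * t) - log_defect t) s :> d \<and> d > 0"
      if "0 < s" "s < x" for s
      using g[of s] g'_pos[of s] that x by auto
    show "continuous_on {0..x} (\<lambda>t. t * ln (1 + c * t) - log_defect t)"
      by (intro continuous_at_imp_continuous_on ballI DERIV_isCont[OF g]) (use x in auto)
  qed fact
  then show ?thesis
    by simp
qed

section \<open>Bounds for the first eigenvalue\<close>

theorem corollary1p4:
  fixes p :: real
  assumes "1 < p"
  shows "p < lambda1 p \<and> lambda1 p < p + pi\<^sup>2 / 6 - 1"
proof
  have x: "0 < 1 / p" "1 / p < 1"
    using assms by auto
  have "p * 1 < p * exp (p * log_defect (1 / p))"
    using log_defect_pos[OF x] assms by (intro mult_strict_left_mono) auto
  then show "p < lambda1 p"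
    using lambda1_eq_exp_log_defect[OF assms] by simp
  define c where "c = pi\<^sup>2 / 6 - 1"
  have "3\<^sup>2 < pi\<^sup>2"
    using pi_approx by (intro power_strict_mono) auto
  then have c: "c > 0"
    by (simp add: c_def)
  have "p * log_defect (1 / p) < p * (1 / p * ln (1 + c * (1 / p)))"
    using log_defect_less[OF x] assms unfolding c_def by (intro mult_strict_left_mono) auto
  then have "exp (p * log_defect (1 / p)) < exp (ln (1 + c / p))"
    using assms by simp
  also have "\<dots> = 1 + c / p"
    using assms c by (simp add: add_pos_pos)
  finally have "lambda1 p < p * (1 + c / p)"
    using lambda1_eq_exp_log_defect[OF assms] assms by simp
  also have "\<dots> = p + pi\<^sup>2 / 6 - 1"
    using assms by (simp add: c_def field_simps)
  finally show "lambda1 p < p + pi\<^sup>2 / 6 - 1" .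
qed

end
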